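(* Let $T$ be a (finite) tree. Then $D(T)=D_{\ell}(T)$.
   Context: A coloring of a graph $G$ is a map $\phi:V(G)\to\mathbb{N}$; a $k$-coloring maps into $[k]=\{1,\dots,k\}$. A coloring is distinguishing if no nontrivial automorphism of $G$ preserves all vertex colors (i.e. there is no nonidentity automorphism $\sigma$ with $\phi(\sigma(v))=\phi(v)$ for all $v$). The distinguishing number $D(G)$ is the minimum number of colors in a distinguishing coloring of $G$. Given a list assignment $L=\{L(v)\}_{v\in V(G)}$, $G$ is $L$-distinguishable if there is a distinguishing coloring $f$ with $f(v)\in L(v)$ for all $v$. The list distinguishing number $D_\ell(G)$ is the minimum integer $k$ such that $G$ is $L$-distinguishable for every list assignment $L$ with $|L(v)|=k$ for all $v$. *)

theory Defs
  imports "Graph_Theory.Digraph_Component" "HOL-Combinatorics.Permutations"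
begin

text \<open>
  Finite simple graphs are the library's \<^locale>\<open>pair_graph\<close>: a finite vertex set with a finite,
  symmetric, loop-free set of arcs, an undirected edge being a pair of opposite arcs.  The library's
  \<^const>\<open>Digraph_Component.tree\<close> is not the right notion for such graphs, because the two arcs
  of an edge already form a directed cycle of length 2; hence only cycles of length at least 3
  count as cycles of the undirected graph.  Connectedness includes that there is a vertex.
\<close>

definition undirected_tree :: "'a pair_pre_digraph \<Rightarrow> bool" where
  "undirected_tree G \<longleftrightarrow> pair_graph G \<and> Digraph_Component.connected (with_proj G) \<and>
     \<not> (\<exists>p. pre_digraph.cycle (with_proj G) p \<and> 3 \<le> length p)"

text \<open>Automorphisms are extended by the identity outside the vertex set.\<close>

definition graph_automorphism :: "'a pair_pre_digraph \<Rightarrow> ('a \<Rightarrow> 'a) \<Rightarrow> bool" where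
  "graph_automorphism G \<sigma> \<longleftrightarrow> \<sigma> permutes pverts G \<and>
     (\<forall>u\<in>pverts G. \<forall>v\<in>pverts G. (\<sigma> u, \<sigma> v) \<in> parcs G \<longleftrightarrow> (u, v) \<in> parcs G)"

definition distinguishing :: "'a pair_pre_digraph \<Rightarrow> ('a \<Rightarrow> nat) \<Rightarrow> bool" where
  "distinguishing G \<phi> \<longleftrightarrow>
     \<not> (\<exists>\<sigma>. graph_automorphism G \<sigma> \<and> \<sigma> \<noteq> id \<and> (\<forall>v\<in>pverts G. \<phi> (\<sigma> v) = \<phi> v))"

definition k_coloring :: "'a pair_pre_digraph \<Rightarrow> nat \<Rightarrow> ('a \<Rightarrow> nat) \<Rightarrow> bool" where
  "k_coloring G k \<phi> \<longleftrightarrow> (\<forall>v\<in>pverts G. \<phi> v \<in> {1..k})"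

definition distinguishing_number :: "'a pair_pre_digraph \<Rightarrow> nat" where
  "distinguishing_number G = (LEAST k. \<exists>\<phi>. k_coloring G k \<phi> \<and> distinguishing G \<phi>)"

definition list_distinguishable :: "'a pair_pre_digraph \<Rightarrow> ('a \<Rightarrow> nat set) \<Rightarrow> bool" where
  "list_distinguishable G L \<longleftrightarrow> (\<exists>f. distinguishing G f \<and> (\<forall>v\<in>pverts G. f v \<in> L v))"

definition list_distinguishing_number :: "'a pair_pre_digraph \<Rightarrow> nat" where
  "list_distinguishing_number G =
     (LEAST k. \<forall>L. (\<forall>v\<in>pverts G. finite (L v) \<and> card (L v) = k) \<longrightarrow> list_distinguishable G L)"

text \<open>
  Both minima are attained on finite graphs, and the first one is also the least number of
  colors actually used by a distinguishing coloring.
\<close>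

lemma inj_on_imp_distinguishing:
  assumes "inj_on \<phi> (pverts G)"
  shows "distinguishing G \<phi>"
proof -
  have "\<sigma> = id" if "\<sigma> permutes pverts G" "\<forall>v\<in>pverts G. \<phi> (\<sigma> v) = \<phi> v" for \<sigma>
  proof
    fix v show "\<sigma> v = id v"
    proof (cases "v \<in> pverts G")
      case True
      then have "\<sigma> v \<in> pverts G" using that(1) by (simp add: permutes_in_image)
      then show ?thesis using inj_onD[OF assms, of "\<sigma> v" v] True that(2) by simp
    next
      case False
      then show ?thesis using that(1) by (simp add: permutes_not_in)
    qed
  qed
  then show ?thesis by (auto simp: distinguishing_def graph_automorphism_def)
qed

lemma distinguishing_inj_comp:
  assumes "distinguishing G \<phi>" "inj_on h (\<phi> ` pverts G)"
  shows "distinguishing G (h \<circ> \<phi>)"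
  unfolding distinguishing_def
proof (rule notI, elim exE conjE)
  fix \<sigma> assume a: "graph_automorphism G \<sigma>" "\<sigma> \<noteq> id" "\<forall>v\<in>pverts G. (h \<circ> \<phi>) (\<sigma> v) = (h \<circ> \<phi>) v"
  have "\<phi> (\<sigma> v) = \<phi> v" if "v \<in> pverts G" for v
  proof -
    have "\<sigma> v \<in> pverts G" using a(1) that by (simp add: graph_automorphism_def permutes_in_image)
    then show ?thesis using inj_onD[OF assms(2), of "\<phi> (\<sigma> v)" "\<phi> v"] a(3) that by simp
  qed
  then show False using a(1,2) assms(1) by (auto simp: distinguishing_def)
qed

lemma distinguishing_recolor:
  assumes "finite (pverts G)" "distinguishing G \<phi>"
  shows "\<exists>\<psi>. k_coloring G (card (\<phi> ` pverts G)) \<psi> \<and> distinguishing G \<psi>"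
proof -
  obtain h where h: "bij_betw h (\<phi> ` pverts G) {1..card (\<phi> ` pverts G)}"
    using assms(1) finite_same_card_bij[of "\<phi> ` pverts G" "{1..card (\<phi> ` pverts G)}"] by auto
  then have "distinguishing G (h \<circ> \<phi>)"
    using distinguishing_inj_comp[OF assms(2)] by (simp add: bij_betw_def)
  moreover have "k_coloring G (card (\<phi> ` pverts G)) (h \<circ> \<phi>)"
    unfolding k_coloring_def using bij_betwE[OF h] by simp
  ultimately show ?thesis by blast
qed

lemma distinguishing_number_attained:
  assumes "finite (pverts G)"
  shows "\<exists>\<phi>. k_coloring G (distinguishing_number G) \<phi> \<and> distinguishing G \<phi>"
proof -
  obtain h :: "'a \<Rightarrow> nat" where "inj_on h (pverts G)"
    using finite_imp_inj_to_nat_seg[OF assms] by auto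
  from distinguishing_recolor[OF assms inj_on_imp_distinguishing[OF this]]
  have "\<exists>k \<phi>. k_coloring G k \<phi> \<and> distinguishing G \<phi>" by (rule exI)
  then show ?thesis unfolding distinguishing_number_def by (rule LeastI_ex)
qed

lemma distinguishing_number_altdef:
  assumes "finite (pverts G)"
  shows "distinguishing_number G = (LEAST k. \<exists>\<phi>. distinguishing G \<phi> \<and> card (\<phi> ` pverts G) = k)"
proof (rule Least_equality[symmetric])
  have least: "distinguishing_number G \<le> card (\<phi> ` pverts G)" if "distinguishing G \<phi>" for \<phi>
    unfolding distinguishing_number_def
    by (rule Least_le) (rule distinguishing_recolor[OF assms that])
  obtain \<phi> where \<phi>: "k_coloring G (distinguishing_number G) \<phi>" "distinguishing G \<phi>"
    using distinguishing_number_attained[OF assms] by blast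
  have "card (\<phi> ` pverts G) \<le> card {1..distinguishing_number G}"
    using \<phi>(1) by (intro card_mono) (auto simp: k_coloring_def)
  with least[OF \<phi>(2)] \<phi>(2)
  show "\<exists>\<phi>. distinguishing G \<phi> \<and> card (\<phi> ` pverts G) = distinguishing_number G" by auto
  show "distinguishing_number G \<le> k" if "\<exists>\<phi>. distinguishing G \<phi> \<and> card (\<phi> ` pverts G) = k" for k
    using that least by blast
qed

lemma inj_choice_from_lists:
  assumes "finite A" "\<forall>v\<in>A. finite (L v) \<and> card A \<le> card (L v)"
  shows "\<exists>f. inj_on f A \<and> (\<forall>v\<in>A. f v \<in> L v)"
  using assms
proof (induction A rule: finite_induct)
  case (insert a A)
  have "\<forall>v\<in>A. finite (L v) \<and> card A \<le> card (L v)"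
    using insert.prems insert.hyps by (simp add: Suc_le_eq less_imp_le)
  then obtain f where f: "inj_on f A" "\<forall>v\<in>A. f v \<in> L v" using insert.IH by blast
  have "card A < card (L a)" using insert.prems insert.hyps by simp
  then have "card (f ` A) < card (L a)" using card_image_le[OF insert.hyps(1), of f] by linarith
  then have "\<not> L a \<subseteq> f ` A"
    using card_mono[of "f ` A" "L a"] insert(1) by auto
  then obtain c where c: "c \<in> L a" "c \<notin> f ` A" by blast
  have "inj_on (f(a := c)) (insert a A)"
    using f(1) c(2) insert(2) by (auto simp: inj_on_def)
  moreover have "\<forall>v\<in>insert a A. (f(a := c)) v \<in> L v" using f(2) c(1) by auto
  ultimately show ?case by blast
qed simp

lemma list_distinguishing_number_attained:
  assumes "finite (pverts G)"
    and "\<forall>v\<in>pverts G. finite (L v) \<and> card (L v) = list_distinguishing_number G"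
  shows "list_distinguishable G L"
proof -
  have "\<forall>L. (\<forall>v\<in>pverts G. finite (L v) \<and> card (L v) = card (pverts G)) \<longrightarrow> list_distinguishable G L"
  proof (intro allI impI)
    fix L :: "'a \<Rightarrow> nat set"
    assume "\<forall>v\<in>pverts G. finite (L v) \<and> card (L v) = card (pverts G)"
    then obtain f where "inj_on f (pverts G)" "\<forall>v\<in>pverts G. f v \<in> L v"
      using inj_choice_from_lists[OF assms(1), of L] by auto
    then show "list_distinguishable G L"
      using inj_on_imp_distinguishing unfolding list_distinguishable_def by blast
  qed
  then have "\<forall>L. (\<forall>v\<in>pverts G. finite (L v) \<and> card (L v) = list_distinguishing_number G)
               \<longrightarrow> list_distinguishable G L"
    unfolding list_distinguishing_number_def by (rule LeastI)
  then show ?thesis using assms(2) by blast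
qed

end

theory Submission
  imports Defs "HOL-Combinatorics.Orbits" "HOL-Library.Nat_Bijection"
begin

text \<open>
  Remove all leaves of the tree at once, recording at each remaining vertex its own color together
  with the set of colors of the leaves attached to it.  A coloring is distinguishing iff leaves
  with a common neighbour get distinct colors and the recorded coloring of the smaller tree is
  distinguishing.  The possible records at a vertex form a new list, so the induction compares two
  list assignments: one, \<open>K\<close>, in which any two lists are equal or disjoint (at the start, all of
  them are \<open>{1..k}\<close>), and an arbitrary one, \<open>L\<close>, whose lists are at least as large and are disjoint
  wherever those of \<open>K\<close> are.  These hypotheses survive the removal of the leaves because \<open>L\<close> has
  at least as many transversals as \<open>K\<close> on each set of leaves with a common neighbour.  The process
  ends with at most two vertices, where distinguishing means injective.
\<close>

section \<open>Transversals\<close>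

definition transversals :: "'i set \<Rightarrow> ('i \<Rightarrow> 'c set) \<Rightarrow> 'c set set" where
  "transversals I F = {X. \<exists>f. bij_betw f I X \<and> (\<forall>i\<in>I. f i \<in> F i)}"

lemma transversalsI: "bij_betw f I X \<Longrightarrow> \<forall>i\<in>I. f i \<in> F i \<Longrightarrow> X \<in> transversals I F"
  unfolding transversals_def by blast

lemma transversalsE:
  assumes "X \<in> transversals I F"
  obtains f where "bij_betw f I X" "\<forall>i\<in>I. f i \<in> F i"
  using assms unfolding transversals_def by blast

lemma transversals_nonempty_iff:
  "transversals I F \<noteq> {} \<longleftrightarrow> (\<exists>f. inj_on f I \<and> (\<forall>i\<in>I. f i \<in> F i))"
  unfolding transversals_def bij_betw_def by blast

lemma transversal_subset_Union: "X \<in> transversals I F \<Longrightarrow> X \<subseteq> (\<Union>i\<in>I. F i)"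
  by (force simp: bij_betw_def elim!: transversalsE)

lemma finite_transversal: "finite I \<Longrightarrow> X \<in> transversals I F \<Longrightarrow> finite X"
  by (auto simp: bij_betw_finite elim: transversalsE)

lemma finite_transversals:
  assumes "finite I" "\<And>i. i \<in> I \<Longrightarrow> finite (F i)"
  shows "finite (transversals I F)"
proof (rule finite_subset)
  show "transversals I F \<subseteq> Pow (\<Union>i\<in>I. F i)" using transversal_subset_Union by blast
  show "finite (Pow (\<Union>i\<in>I. F i))" using assms by simp
qed

lemma insert_in_transversals:
  assumes "i \<in> I" "x \<in> F i" "X \<in> transversals (I - {i}) (\<lambda>j. F j - {x})"
  shows "insert x X \<in> transversals I F"
proof -
  obtain f where f_bij: "bij_betw f (I - {i}) X" and f_in: "\<forall>j\<in>I - {i}. f j \<in> F j - {x}"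
    using assms(3) by (rule transversalsE)
  have "x \<notin> X" using transversal_subset_Union[OF assms(3)] by blast
  moreover have "bij_betw (f(i := x)) (I - {i}) X"
    using f_bij by (subst bij_betw_cong[of _ _ f]) auto
  ultimately have "bij_betw (f(i := x)) (insert i (I - {i})) (insert x X)"
    using notIn_Un_bij_betw[of i "I - {i}" "f(i := x)" X] by simp
  then have "bij_betw (f(i := x)) I (insert x X)" using assms(1) by (simp add: insert_absorb)
  then show ?thesis using f_in assms(2) by (intro transversalsI) auto
qed

lemma Diff_in_transversals:
  assumes "X \<in> transversals I F" "a \<in> X" "i \<in> I" "\<And>j. j \<in> I \<Longrightarrow> a \<in> F j \<Longrightarrow> F j = F i"
  shows "X - {a} \<in> transversals (I - {i}) (\<lambda>j. F j - {a})"
proof -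
  obtain f where f_bij: "bij_betw f I X" and f_in: "\<forall>j\<in>I. f j \<in> F j"
    using assms(1) by (rule transversalsE)
  obtain j where j: "j \<in> I" "f j = a" using f_bij assms(2) by (auto simp: bij_betw_def)
  have same_list: "F j = F i" using assms(4) f_in j by blast
  define g where "g = f \<circ> transpose i j"
  have "transpose i j permutes I" using assms(3) j(1) by (rule permutes_swap_id)
  then have g_bij: "bij_betw g I X"
    using f_bij by (auto simp: g_def intro: bij_betw_trans permutes_imp_bij)
  have g_i: "g i = a" using j(2) by (simp add: g_def)
  have "bij_betw g (I - {i}) (X - {a})"
    using bij_betw_DiffI[OF g_bij, of "{i}" "{a}"] g_i assms(2,3) by simp
  moreover have "\<forall>k\<in>I - {i}. g k \<in> F k - {a}"
  proof (intro ballI DiffI)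
    fix k assume k: "k \<in> I - {i}"
    show "g k \<in> F k"
      using k f_in j(1) assms(3) same_list by (cases "k = j") (auto simp: g_def)
    show "g k \<notin> {a}" using k g_bij g_i assms(3) by (auto simp: bij_betw_def inj_on_def)
  qed
  ultimately show ?thesis by (rule transversalsI)
qed

lemma in_transversals_Diff_iff:
  "X \<in> transversals I (\<lambda>j. F j - {a}) \<longleftrightarrow> X \<in> transversals I F \<and> a \<notin> X"
  by (auto simp: transversals_def bij_betw_def)

lemma card_transversals_ge_split:
  assumes "finite I" "\<And>j. j \<in> I \<Longrightarrow> finite (F j)" "i \<in> I" "x \<in> F i"
  shows "card (transversals (I - {i}) (\<lambda>j. F j - {x})) + card (transversals I (\<lambda>j. F j - {x}))
           \<le> card (transversals I F)" (is "card ?S + card ?T \<le> _")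
proof -
  have fin: "finite ?S" "finite ?T" using assms(1,2) by (auto intro: finite_transversals)
  have "x \<notin> X" if "X \<in> ?S" for X using transversal_subset_Union[OF that] by blast
  then have "inj_on (insert x) ?S" by (intro inj_onI) (metis insert_ident)
  then have "card ?S + card ?T = card (insert x ` ?S) + card ?T" by (simp add: card_image)
  also have "\<dots> = card (insert x ` ?S \<union> ?T)"
    using fin by (intro card_Un_disjoint[symmetric]) (auto simp: in_transversals_Diff_iff)
  also have "\<dots> \<le> card (transversals I F)"
    using assms insert_in_transversals[of i I x F]
    by (intro card_mono finite_transversals) (auto simp: in_transversals_Diff_iff)
  finally show ?thesis .
qed

lemma card_transversals_le_split:
  assumes "finite I" "\<And>j. j \<in> I \<Longrightarrow> finite (F j)" "i \<in> I"
    and "\<And>j. j \<in> I \<Longrightarrow> a \<in> F j \<Longrightarrow> F j = F i"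
  shows "card (transversals I F)
           \<le> card (transversals (I - {i}) (\<lambda>j. F j - {a})) + card (transversals I (\<lambda>j. F j - {a}))"
    (is "_ \<le> card ?S + card ?T")
proof -
  have fin: "finite ?S" "finite ?T" using assms(1,2) by (auto intro: finite_transversals)
  have "X \<in> insert a ` ?S \<union> ?T" if "X \<in> transversals I F" for X
  proof (cases "a \<in> X")
    case True
    then have "X = insert a (X - {a})" by blast
    then show ?thesis using Diff_in_transversals[OF that True assms(3,4)] by blast
  next
    case False
    then show ?thesis using that by (simp add: in_transversals_Diff_iff)
  qed
  then have "card (transversals I F) \<le> card (insert a ` ?S \<union> ?T)"
    using fin by (intro card_mono) auto
  also have "\<dots> \<le> card (insert a ` ?S) + card ?T" by (rule card_Un_le)
  also have "\<dots> \<le> card ?S + card ?T" using fin by (simp add: card_image_le)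
  finally show ?thesis .
qed

section \<open>Domination of list assignments\<close>

definition separates :: "'i set \<Rightarrow> ('i \<Rightarrow> 'k) \<Rightarrow> ('i \<Rightarrow> 'c set) \<Rightarrow> bool" where
  "separates I K F \<longleftrightarrow> (\<forall>i\<in>I. \<forall>j\<in>I. K i = K j \<or> F i \<inter> F j = {})"

definition lists_dominate :: "'i set \<Rightarrow> ('i \<Rightarrow> 'c set) \<Rightarrow> ('i \<Rightarrow> 'd set) \<Rightarrow> bool" where
  "lists_dominate I L K \<longleftrightarrow> separates I K K \<and> separates I K L \<and>
     (\<forall>i\<in>I. finite (K i) \<and> finite (L i) \<and> card (K i) \<le> card (L i))"

lemma separatesD: "separates I K F \<Longrightarrow> i \<in> I \<Longrightarrow> j \<in> I \<Longrightarrow> c \<in> F i \<Longrightarrow> c \<in> F j \<Longrightarrow> K i = K j"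
  unfolding separates_def by blast

lemma separates_subset: "separates I K F \<Longrightarrow> J \<subseteq> I \<Longrightarrow> separates J K F"
  unfolding separates_def by blast

lemma lists_dominate_subset: "lists_dominate I L K \<Longrightarrow> J \<subseteq> I \<Longrightarrow> lists_dominate J L K"
  unfolding lists_dominate_def separates_def by blast

lemma lists_dominate_Diff:
  assumes "lists_dominate I L K" "i \<in> I" "a \<in> K i" "x \<in> L i"
  shows "lists_dominate I (\<lambda>j. L j - {x}) (\<lambda>j. K j - {a})"
proof -
  have "card (K j - {a}) \<le> card (L j - {x})" if j: "j \<in> I" for j
  proof (cases "K j = K i")
    case True
    have "card (K j - {a}) = card (K j) - 1" using True assms(3) by simp
    also have "\<dots> \<le> card (L j) - 1" using assms(1) j by (simp add: lists_dominate_def diff_le_mono)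
    also have "\<dots> \<le> card (L j - {x})" using diff_card_le_card_Diff[of "{x}" "L j"] by simp
    finally show ?thesis .
  next
    case False
    then have "a \<notin> K j" "x \<notin> L j"
      using assms j by (auto simp: lists_dominate_def dest: separatesD[of I K _ i j])
    then show ?thesis using assms(1) j by (simp add: lists_dominate_def)
  qed
  then show ?thesis using assms(1) unfolding lists_dominate_def separates_def by blast
qed

lemma separates_image:
  assumes "separates I K F" "inj_on h (\<Union>i\<in>I. F i)"
  shows "separates I (\<lambda>i. k ` K i) (\<lambda>i. h ` F i)"
  unfolding separates_def
proof (intro ballI)
  fix i j assume ij: "i \<in> I" "j \<in> I"
  have "h ` F i \<inter> h ` F j = h ` (F i \<inter> F j)"
    using ij by (intro inj_on_image_Int[OF assms(2), symmetric]) auto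
  moreover have "K i = K j \<or> F i \<inter> F j = {}" using assms(1) ij by (simp add: separates_def)
  ultimately show "k ` K i = k ` K j \<or> h ` F i \<inter> h ` F j = {}" by auto
qed

lemma lists_dominate_image:
  assumes "lists_dominate I L K" "inj_on h (\<Union>i\<in>I. L i)" "inj_on k (\<Union>i\<in>I. K i)"
  shows "lists_dominate I (\<lambda>i. h ` L i) (\<lambda>i. k ` K i)"
  unfolding lists_dominate_def
proof (intro conjI ballI)
  show "separates I (\<lambda>i. k ` K i) (\<lambda>i. k ` K i)" "separates I (\<lambda>i. k ` K i) (\<lambda>i. h ` L i)"
    using assms by (simp_all add: lists_dominate_def separates_image)
  fix i assume i: "i \<in> I"
  then show "finite (k ` K i)" "finite (h ` L i)"
    using assms(1) by (simp_all add: lists_dominate_def)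
  have "inj_on h (L i)" "inj_on k (K i)" using assms(2,3) i by (auto intro: inj_on_subset)
  then show "card (k ` K i) \<le> card (h ` L i)"
    using assms(1) i by (simp add: card_image lists_dominate_def)
qed

text \<open>
  Pascal's recursion, on whether a transversal contains a fixed element of the list of \<open>i\<close>, bounds
  the number of transversals of \<open>L\<close> from below.  It bounds that of \<open>K\<close> from above because an element
  of a transversal that lies in the list of \<open>i\<close> can be made to represent \<open>i\<close>.
\<close>

lemma lists_dominate_imp_card_transversals_le:
  assumes "finite I" "lists_dominate I L K"
  shows "card (transversals I K) \<le> card (transversals I L)"
  using assms
proof (induction "card (\<Union>i\<in>I. K i)" arbitrary: I K L rule: less_induct)
  case less
  have finK: "finite (K j)" and finL: "finite (L j)" and card_le: "card (K j) \<le> card (L j)"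
    if "j \<in> I" for j
    using less.prems(2) that by (auto simp: lists_dominate_def)
  consider (no_index) "I = {}" | (empty_list) i where "i \<in> I" "K i = {}"
    | (color) i a where "i \<in> I" "a \<in> K i"
    by blast
  then show ?case
  proof cases
    case no_index
    then show ?thesis by (simp add: transversals_def bij_betw_def)
  next
    case empty_list
    then have "transversals I K = {}" by (auto elim!: transversalsE)
    then show ?thesis by simp
  next
    case (color i a)
    then obtain x where x: "x \<in> L i"
      using finK[of i] card_le[of i] by (metis card.empty card_0_eq empty_iff ex_in_conv le_0_eq)
    let ?K = "\<lambda>j. K j - {a}" and ?L = "\<lambda>j. L j - {x}"
    have IH: "card (transversals J ?K) \<le> card (transversals J ?L)" if J: "J \<subseteq> I" for J
    proof (rule less.hyps)
      have "(\<Union>j\<in>J. ?K j) \<subset> (\<Union>j\<in>I. K j)" using J color by blast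
      then show "card (\<Union>j\<in>J. ?K j) < card (\<Union>j\<in>I. K j)"
        using less.prems(1) finK by (intro psubset_card_mono) auto
      show "finite J" using J less.prems(1) by (rule finite_subset)
      show "lists_dominate J ?L ?K"
        using lists_dominate_Diff[OF less.prems(2) color x] J by (rule lists_dominate_subset)
    qed
    have "card (transversals I K) \<le> card (transversals (I - {i}) ?K) + card (transversals I ?K)"
      using less.prems color finK
      by (intro card_transversals_le_split) (auto simp: lists_dominate_def dest: separatesD)
    also have "\<dots> \<le> card (transversals (I - {i}) ?L) + card (transversals I ?L)"
      using IH by (intro add_mono) auto
    also have "\<dots> \<le> card (transversals I L)"
      using less.prems(1) finL color x by (intro card_transversals_ge_split) auto
    finally show ?thesis .
  qed
qed

lemma lists_dominate_inj_choice:
  assumes "finite I" "lists_dominate I L K" "inj_on f I" "\<forall>i\<in>I. f i \<in> K i"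
  shows "\<exists>g. inj_on g I \<and> (\<forall>i\<in>I. g i \<in> L i)"
proof -
  have "transversals I K \<noteq> {}" using assms(3,4) transversals_nonempty_iff by blast
  moreover have "finite (transversals I K)"
    using assms(1,2) by (intro finite_transversals) (auto simp: lists_dominate_def)
  ultimately have "0 < card (transversals I L)"
    using lists_dominate_imp_card_transversals_le[OF assms(1,2)]
    by (metis card_gt_0_iff less_le_trans)
  then have "transversals I L \<noteq> {}" by auto
  then show ?thesis by (simp add: transversals_nonempty_iff)
qed

lemma separates_transversals_subset:
  assumes "separates (I \<union> J) K F" "X \<in> transversals I F" "X \<in> transversals J F"
  shows "transversals I K \<subseteq> transversals J K"
proof
  fix Y assume "Y \<in> transversals I K"
  then obtain e where e_bij: "bij_betw e I Y" and e_in: "\<forall>i\<in>I. e i \<in> K i"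
    by (rule transversalsE)
  obtain f where f_bij: "bij_betw f I X" and f_in: "\<forall>i\<in>I. f i \<in> F i"
    using assms(2) by (rule transversalsE)
  obtain g where g_bij: "bij_betw g J X" and g_in: "\<forall>j\<in>J. g j \<in> F j"
    using assms(3) by (rule transversalsE)
  define h where "h = inv_into I f \<circ> g"
  have h_bij: "bij_betw h J I"
    unfolding h_def using g_bij bij_betw_inv_into[OF f_bij] by (rule bij_betw_trans)
  have "K (h j) = K j" if j: "j \<in> J" for j
  proof -
    have "f (h j) = g j"
      using f_bij g_bij j by (simp add: h_def bij_betw_inv_into_right bij_betw_apply)
    then have "g j \<in> F (h j)" using f_in h_bij j by (metis bij_betw_apply)
    then show ?thesis
      using assms(1) g_in j bij_betw_apply[OF h_bij j] by (auto dest: separatesD[of _ K F "h j" j])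
  qed
  then have "\<forall>j\<in>J. (e \<circ> h) j \<in> K j"
    using e_in h_bij by (metis bij_betw_apply comp_apply)
  with bij_betw_trans[OF h_bij e_bij] show "Y \<in> transversals J K" by (rule transversalsI)
qed

lemma separates_transversals_eq:
  assumes "separates (I \<union> J) K F" "X \<in> transversals I F" "X \<in> transversals J F"
  shows "transversals I K = transversals J K"
proof (rule equalityI)
  show "transversals I K \<subseteq> transversals J K"
    using assms by (rule separates_transversals_subset)
  show "transversals J K \<subseteq> transversals I K"
    using assms(1) by (intro separates_transversals_subset[OF _ assms(3,2)]) (simp add: Un_commute)
qed

section \<open>Rigid colorings\<close>

definition color_automorphism :: "'a pair_pre_digraph \<Rightarrow> ('a \<Rightarrow> 'c) \<Rightarrow> ('a \<Rightarrow> 'a) \<Rightarrow> bool" where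
  "color_automorphism G \<phi> \<sigma> \<longleftrightarrow> graph_automorphism G \<sigma> \<and> (\<forall>v\<in>pverts G. \<phi> (\<sigma> v) = \<phi> v)"

text \<open>
  This is \<^const>\<open>distinguishing\<close> for colors of any type: the colors of a pruned graph will be pairs
  of a color and a set of colors.
\<close>

definition rigid :: "'a pair_pre_digraph \<Rightarrow> ('a \<Rightarrow> 'c) \<Rightarrow> bool" where
  "rigid G \<phi> \<longleftrightarrow> (\<forall>\<sigma>. color_automorphism G \<phi> \<sigma> \<longrightarrow> \<sigma> = id)"

lemma distinguishing_iff_rigid: "distinguishing G \<phi> \<longleftrightarrow> rigid G \<phi>"
  unfolding distinguishing_def rigid_def color_automorphism_def by blast

lemma graph_automorphism_permutes: "graph_automorphism G \<sigma> \<Longrightarrow> \<sigma> permutes pverts G"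
  by (simp add: graph_automorphism_def)

lemma color_automorphism_permutes: "color_automorphism G \<phi> \<sigma> \<Longrightarrow> \<sigma> permutes pverts G"
  by (simp add: color_automorphism_def graph_automorphism_permutes)

lemma color_automorphism_cong:
  assumes "\<And>u v. u \<in> pverts G \<Longrightarrow> v \<in> pverts G \<Longrightarrow> \<phi> u = \<phi> v \<longleftrightarrow> \<psi> u = \<psi> v"
  shows "color_automorphism G \<phi> \<sigma> \<longleftrightarrow> color_automorphism G \<psi> \<sigma>"
  using assms graph_automorphism_permutes[of G \<sigma>]
  by (auto simp: color_automorphism_def permutes_in_image)

lemma rigid_comp_inj_iff:
  assumes "inj_on h (\<phi> ` pverts G)"
  shows "rigid G (h \<circ> \<phi>) \<longleftrightarrow> rigid G \<phi>"
  unfolding rigid_def using assms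
  by (subst color_automorphism_cong[of G "h \<circ> \<phi>" \<phi>]) (auto dest: inj_onD)

lemma rigid_cong:
  assumes "\<And>v. v \<in> pverts G \<Longrightarrow> \<phi> v = \<psi> v"
  shows "rigid G \<phi> \<longleftrightarrow> rigid G \<psi>"
  unfolding rigid_def using assms by (subst color_automorphism_cong[of G \<phi> \<psi>]) auto

lemma (in pair_fin_digraph) graph_automorphismI:
  assumes inj: "inj_on \<sigma> (pverts G)" and maps: "\<sigma> ` pverts G \<subseteq> pverts G"
    and outside: "\<And>v. v \<notin> pverts G \<Longrightarrow> \<sigma> v = v"
    and hom: "\<And>u v. (u, v) \<in> parcs G \<Longrightarrow> (\<sigma> u, \<sigma> v) \<in> parcs G"
  shows "graph_automorphism G \<sigma>"
proof -
  have "\<sigma> ` pverts G = pverts G" using pair_finite_verts maps inj by (rule endo_inj_surj)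
  then have perm: "\<sigma> permutes pverts G"
    using inj outside by (intro bij_imp_permutes) (auto simp: bij_betw_def)
  have inj_arcs: "inj (map_prod \<sigma> \<sigma>)" using permutes_inj[OF perm] by (simp add: prod.inj_map)
  have "map_prod \<sigma> \<sigma> ` parcs G = parcs G"
    using hom inj_arcs by (intro endo_inj_surj pair_finite_arcs) (auto intro: inj_on_subset)
  then have "(\<sigma> u, \<sigma> v) \<in> parcs G \<longleftrightarrow> (u, v) \<in> parcs G" for u v
    using inj_image_mem_iff[OF inj_arcs, of "(u, v)" "parcs G"] by simp
  then show ?thesis using perm by (simp add: graph_automorphism_def)
qed

definition neighbours :: "'a pair_pre_digraph \<Rightarrow> 'a \<Rightarrow> 'a set" where
  "neighbours G v = {u. (v, u) \<in> parcs G}"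

lemma (in pair_digraph) neighbours_subset: "neighbours G v \<subseteq> pverts G - {v}"
  using in_arcsD2 no_loops' by (auto simp: neighbours_def)

lemma (in pair_digraph) finite_neighbours: "finite (neighbours G v)"
  using finite_subset[OF neighbours_subset] by simp

lemma (in pair_wf_digraph) neighbours_automorphism:
  assumes "graph_automorphism G \<sigma>"
  shows "neighbours G (\<sigma> v) = \<sigma> ` neighbours G v"
proof (cases "v \<in> pverts G")
  case True
  have "neighbours G (\<sigma> v) = {u \<in> \<sigma> ` pverts G. (\<sigma> v, u) \<in> parcs G}"
    using permutes_image[OF graph_automorphism_permutes[OF assms]] in_arcsD2
    by (auto simp: neighbours_def)
  also have "\<dots> = \<sigma> ` neighbours G v"
    using assms True in_arcsD2 by (auto simp: neighbours_def graph_automorphism_def)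
  finally show ?thesis .
next
  case False
  then have "\<sigma> v = v" using permutes_not_in[OF graph_automorphism_permutes[OF assms]] by blast
  moreover have "neighbours G v = {}" using False in_arcsD1 by (auto simp: neighbours_def)
  ultimately show ?thesis by simp
qed

lemma (in pair_graph) graph_automorphism_transpose_twins:
  assumes "a \<in> pverts G" "b \<in> pverts G" "neighbours G a - {b} = neighbours G b - {a}"
  shows "graph_automorphism G (transpose a b)"
proof (rule graph_automorphismI)
  have from_twins: "(a, w) \<in> parcs G \<longleftrightarrow> (b, w) \<in> parcs G" if "w \<noteq> a" "w \<noteq> b" for w
    using assms(3) that by (auto simp: neighbours_def)
  have to_twins: "(w, a) \<in> parcs G \<longleftrightarrow> (w, b) \<in> parcs G" if "w \<noteq> a" "w \<noteq> b" for w
    using from_twins[OF that] arcs_symmetric by blast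
  show "(transpose a b u, transpose a b v) \<in> parcs G" if uv: "(u, v) \<in> parcs G" for u v
  proof -
    consider (inside) "u \<in> {a, b}" "v \<in> {a, b}" | (leaving) "u \<in> {a, b}" "v \<notin> {a, b}"
      | (entering) "u \<notin> {a, b}" "v \<in> {a, b}" | (outside) "u \<notin> {a, b}" "v \<notin> {a, b}"
      by blast
    then show ?thesis
    proof cases
      case inside
      then show ?thesis using arcs_symmetric[OF uv] no_loops'[OF uv] by auto
    next
      case leaving
      then show ?thesis using from_twins[of v] uv by auto
    next
      case entering
      then show ?thesis using to_twins[of u] uv by auto
    next
      case outside
      then show ?thesis using uv by simp
    qed
  qed
qed (use assms(1,2) in \<open>auto simp: transpose_def\<close>)

lemma (in pair_graph) rigid_twins_eq:
  assumes "rigid G \<phi>" "a \<in> pverts G" "b \<in> pverts G" "\<phi> a = \<phi> b"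
    and "neighbours G a - {b} = neighbours G b - {a}"
  shows "a = b"
proof -
  have "transpose a b = id"
    using graph_automorphism_transpose_twins[OF assms(2,3,5)] assms(1,4)
    by (auto simp: rigid_def color_automorphism_def transpose_def)
  then show ?thesis by (metis id_apply transpose_apply_first)
qed

lemma (in pair_graph) inj_on_if_rigid_card_le_2:
  assumes "rigid G \<phi>" "card (pverts G) \<le> 2"
  shows "inj_on \<phi> (pverts G)"
proof (rule inj_onI, rule ccontr)
  fix a b assume ab: "a \<in> pverts G" "b \<in> pverts G" "\<phi> a = \<phi> b" "a \<noteq> b"
  then have "pverts G = {a, b}" using assms(2) by (intro card_seteq[symmetric]) auto
  then have "neighbours G a \<subseteq> {b}" "neighbours G b \<subseteq> {a}"
    using neighbours_subset[of a] neighbours_subset[of b] by auto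
  then have "neighbours G a - {b} = neighbours G b - {a}" by blast
  then show False using rigid_twins_eq[OF assms(1) ab(1-3)] ab(4) by simp
qed

section \<open>Pruning the leaves of a graph\<close>

definition leaves :: "'a pair_pre_digraph \<Rightarrow> 'a set" where
  "leaves G = {v \<in> pverts G. card (neighbours G v) = 1}"

definition pendants :: "'a pair_pre_digraph \<Rightarrow> 'a \<Rightarrow> 'a set" where
  "pendants G v = neighbours G v \<inter> leaves G"

definition prune :: "'a pair_pre_digraph \<Rightarrow> 'a pair_pre_digraph" where
  "prune G = \<lparr>pverts = pverts G - leaves G, parcs = Restr (parcs G) (pverts G - leaves G)\<rparr>"

definition pruned_coloring :: "'a pair_pre_digraph \<Rightarrow> ('a \<Rightarrow> 'c) \<Rightarrow> 'a \<Rightarrow> 'c \<times> 'c set" where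
  "pruned_coloring G \<phi> v = (\<phi> v, \<phi> ` pendants G v)"

lemma prune_simps [simp]:
  "pverts (prune G) = pverts G - leaves G"
  "parcs (prune G) = Restr (parcs G) (pverts G - leaves G)"
  by (simp_all add: prune_def)

lemma leaves_subset: "leaves G \<subseteq> pverts G"
  by (auto simp: leaves_def)

lemma pendants_subset: "pendants G v \<subseteq> pverts G"
  by (auto simp: pendants_def leaves_def)

lemma (in pair_digraph) finite_pendants: "finite (pendants G v)"
  using finite_neighbours by (simp add: pendants_def)

lemma (in pair_graph) pair_graph_prune: "pair_graph (prune G)"
  by unfold_locales (auto simp: symmetric_def intro!: symI dest: arcs_symmetric no_loops')

lemma (in pair_wf_digraph) leaves_automorphism_iff:
  assumes "graph_automorphism G \<sigma>"
  shows "\<sigma> v \<in> leaves G \<longleftrightarrow> v \<in> leaves G"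
proof -
  note perm = graph_automorphism_permutes[OF assms]
  have "card (neighbours G (\<sigma> v)) = card (neighbours G v)"
    unfolding neighbours_automorphism[OF assms] using permutes_inj_on[OF perm] by (rule card_image)
  then show ?thesis by (simp add: leaves_def permutes_in_image[OF perm])
qed

lemma (in pair_wf_digraph) pendants_automorphism:
  assumes "graph_automorphism G \<sigma>"
  shows "pendants G (\<sigma> v) = \<sigma> ` pendants G v"
  using neighbours_automorphism[OF assms] leaves_automorphism_iff[OF assms]
  by (auto simp: pendants_def)

lemma (in pair_fin_digraph) color_automorphism_prune:
  assumes "color_automorphism G \<phi> \<sigma>"
  shows "color_automorphism (prune G) (pruned_coloring G \<phi>)
    (perm_restrict \<sigma> (pverts (prune G)))" (is "color_automorphism _ _ ?\<rho>")
proof -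
  have aut: "graph_automorphism G \<sigma>" and color_eq: "\<And>v. v \<in> pverts G \<Longrightarrow> \<phi> (\<sigma> v) = \<phi> v"
    using assms by (auto simp: color_automorphism_def)
  note perm = graph_automorphism_permutes[OF aut]
  have core_iff: "\<sigma> v \<in> pverts (prune G) \<longleftrightarrow> v \<in> pverts (prune G)" for v
    using permutes_in_image[OF perm] leaves_automorphism_iff[OF aut] by simp
  have "?\<rho> permutes pverts (prune G)"
  proof (rule bij_imp_permutes)
    have "\<sigma> ` pverts (prune G) = pverts (prune G)"
      using core_iff permutes_inj_on[OF perm] by (intro endo_inj_surj) auto
    then show "bij_betw ?\<rho> (pverts (prune G)) (pverts (prune G))"
      using permutes_inj_on[OF perm] by (auto simp: bij_betw_def inj_on_def perm_restrict_simps)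
  qed (simp add: perm_restrict_simps)
  moreover have "(?\<rho> u, ?\<rho> v) \<in> parcs (prune G) \<longleftrightarrow> (u, v) \<in> parcs (prune G)"
    if "u \<in> pverts (prune G)" "v \<in> pverts (prune G)" for u v
    using that aut core_iff by (auto simp: graph_automorphism_def perm_restrict_simps)
  moreover have "pruned_coloring G \<phi> (?\<rho> v) = pruned_coloring G \<phi> v"
    if "v \<in> pverts (prune G)" for v
  proof -
    have "\<phi> ` \<sigma> ` pendants G v = \<phi> ` pendants G v"
      unfolding image_image using color_eq
      by (intro image_cong) (auto dest: subsetD[OF pendants_subset])
    then show ?thesis
      using that color_eq
      by (simp add: pruned_coloring_def perm_restrict_simps pendants_automorphism[OF aut])
  qed
  ultimately show ?thesis by (simp add: color_automorphism_def graph_automorphism_def)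
qed

lemma (in pair_graph) inj_on_pendants_if_rigid:
  assumes "rigid G \<phi>"
  shows "inj_on \<phi> (pendants G v)"
proof (rule inj_onI)
  fix a b assume ab: "a \<in> pendants G v" "b \<in> pendants G v" "\<phi> a = \<phi> b"
  have "neighbours G u = {v}" if "u \<in> pendants G v" for u
  proof -
    have "v \<in> neighbours G u" "card (neighbours G u) = 1"
      using that arcs_symmetric by (auto simp: pendants_def leaves_def neighbours_def)
    then show ?thesis by (auto simp: card_1_singleton_iff)
  qed
  moreover have "v \<notin> pendants G v" using neighbours_subset by (auto simp: pendants_def)
  ultimately show "a = b"
    using ab by (intro rigid_twins_eq[OF assms]) (auto dest: subsetD[OF pendants_subset])
qed

locale prunable_graph = pair_graph +
  assumes leaves_nonadjacent: "u \<in> leaves G \<Longrightarrow> v \<in> leaves G \<Longrightarrow> (u, v) \<notin> parcs G"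
begin

definition parent :: "'a \<Rightarrow> 'a" where
  "parent u = the_elem (neighbours G u)"

lemma leaf_arc_iff:
  assumes "u \<in> leaves G"
  shows "(u, v) \<in> parcs G \<longleftrightarrow> v = parent u"
proof -
  have "is_singleton (neighbours G u)" using assms by (simp add: leaves_def is_singleton_altdef)
  then have "neighbours G u = {parent u}" by (simp add: parent_def is_singleton_the_elem)
  then show ?thesis by (auto simp: neighbours_def)
qed

lemma parent_in_prune:
  assumes "u \<in> leaves G"
  shows "parent u \<in> pverts (prune G)"
proof -
  have "(u, parent u) \<in> parcs G" using leaf_arc_iff[OF assms] by simp
  then show ?thesis using leaves_nonadjacent[OF assms] in_arcsD2 by auto
qed

lemma pendants_iff: "u \<in> pendants G v \<longleftrightarrow> u \<in> leaves G \<and> parent u = v"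
  using leaf_arc_iff[of u v] arcs_symmetric[of u v] arcs_symmetric[of v u]
  by (auto simp: pendants_def neighbours_def)

definition leaf_extension :: "('a \<Rightarrow> 'c) \<Rightarrow> ('a \<Rightarrow> 'a) \<Rightarrow> 'a \<Rightarrow> 'a" where
  "leaf_extension \<phi> \<sigma> x =
     (if x \<in> leaves G then inv_into (pendants G (\<sigma> (parent x))) \<phi> (\<phi> x) else \<sigma> x)"

lemma leaf_extension_core: "x \<notin> leaves G \<Longrightarrow> leaf_extension \<phi> \<sigma> x = \<sigma> x"
  by (simp add: leaf_extension_def)

context
  fixes \<phi> :: "'a \<Rightarrow> 'c" and \<sigma> :: "'a \<Rightarrow> 'a"
  assumes aut: "color_automorphism (prune G) (pruned_coloring G \<phi>) \<sigma>"
begin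

lemma leaf_extension_leaf:
  assumes "x \<in> leaves G"
  shows "leaf_extension \<phi> \<sigma> x \<in> leaves G"
    "parent (leaf_extension \<phi> \<sigma> x) = \<sigma> (parent x)"
    "\<phi> (leaf_extension \<phi> \<sigma> x) = \<phi> x"
proof -
  let ?\<tau> = "leaf_extension \<phi> \<sigma>"
  have "\<phi> ` pendants G (\<sigma> (parent x)) = \<phi> ` pendants G (parent x)"
    using aut parent_in_prune[OF assms] by (simp add: color_automorphism_def pruned_coloring_def)
  moreover have "x \<in> pendants G (parent x)" using assms by (simp add: pendants_iff)
  ultimately have "\<phi> x \<in> \<phi> ` pendants G (\<sigma> (parent x))" by blast
  then have "?\<tau> x \<in> pendants G (\<sigma> (parent x))" "\<phi> (?\<tau> x) = \<phi> x"
    using assms by (simp_all add: leaf_extension_def inv_into_into f_inv_into_f)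
  then show "?\<tau> x \<in> leaves G" "parent (?\<tau> x) = \<sigma> (parent x)" "\<phi> (?\<tau> x) = \<phi> x"
    by (simp_all add: pendants_iff)
qed

lemma leaf_extension_core_in_prune:
  "x \<in> pverts (prune G) \<Longrightarrow> leaf_extension \<phi> \<sigma> x \<in> pverts (prune G)"
  using permutes_in_image[OF color_automorphism_permutes[OF aut], of x]
  by (simp add: leaf_extension_core)

lemma inj_on_leaf_extension:
  assumes inj: "\<And>v. v \<in> pverts (prune G) \<Longrightarrow> inj_on \<phi> (pendants G v)"
  shows "inj_on (leaf_extension \<phi> \<sigma>) (pverts G)"
proof (rule inj_onI)
  let ?\<tau> = "leaf_extension \<phi> \<sigma>"
  note \<sigma>_inj = inj_eq[OF permutes_inj[OF color_automorphism_permutes[OF aut]]]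
  fix x y assume xy: "x \<in> pverts G" "y \<in> pverts G" "?\<tau> x = ?\<tau> y"
  have "?\<tau> z \<in> leaves G \<longleftrightarrow> z \<in> leaves G" if "z \<in> pverts G" for z
    using that leaf_extension_leaf(1)[of z] leaf_extension_core_in_prune[of z] by auto
  then consider (leaves) "x \<in> leaves G" "y \<in> leaves G" | (core) "x \<notin> leaves G" "y \<notin> leaves G"
    using xy by metis
  then show "x = y"
  proof cases
    case leaves
    then have "\<sigma> (parent x) = \<sigma> (parent y)" "\<phi> x = \<phi> y"
      using leaf_extension_leaf(2,3) xy(3) by metis+
    then show ?thesis
      using inj_onD[OF inj[OF parent_in_prune[OF leaves(1)]]] leaves
      by (simp add: \<sigma>_inj pendants_iff)
  next
    case core
    then show ?thesis using xy(3) by (simp add: leaf_extension_core \<sigma>_inj)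
  qed
qed

lemma leaf_extension_arc:
  assumes uv: "(u, v) \<in> parcs G"
  shows "(leaf_extension \<phi> \<sigma> u, leaf_extension \<phi> \<sigma> v) \<in> parcs G"
proof -
  let ?\<tau> = "leaf_extension \<phi> \<sigma>"
  have to_parent: "(?\<tau> x, ?\<tau> (parent x)) \<in> parcs G" if "x \<in> leaves G" for x
    using leaf_extension_leaf[OF that] parent_in_prune[OF that]
    by (simp add: leaf_arc_iff leaf_extension_core)
  consider (tail_leaf) "u \<in> leaves G" | (head_leaf) "v \<in> leaves G"
    | (core) "u \<notin> leaves G" "v \<notin> leaves G"
    by blast
  then show ?thesis
  proof cases
    case tail_leaf
    then show ?thesis using to_parent uv by (simp add: leaf_arc_iff)
  next
    case head_leaf
    moreover from this have "u = parent v" using arcs_symmetric[OF uv] by (simp add: leaf_arc_iff)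
    ultimately show ?thesis using arcs_symmetric to_parent by blast
  next
    case core
    then have "(\<sigma> u, \<sigma> v) \<in> parcs (prune G)"
      using aut uv in_arcsD1 in_arcsD2
      by (auto simp: color_automorphism_def graph_automorphism_def)
    then show ?thesis using core by (simp add: leaf_extension_core)
  qed
qed

lemma color_automorphism_leaf_extension:
  assumes "\<And>v. v \<in> pverts (prune G) \<Longrightarrow> inj_on \<phi> (pendants G v)"
  shows "color_automorphism G \<phi> (leaf_extension \<phi> \<sigma>)"
proof -
  let ?\<tau> = "leaf_extension \<phi> \<sigma>"
  have "graph_automorphism G ?\<tau>"
  proof (rule graph_automorphismI)
    show "inj_on ?\<tau> (pverts G)" using assms by (rule inj_on_leaf_extension)
    have "?\<tau> v \<in> pverts G" if "v \<in> pverts G" for v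
      using that leaf_extension_leaf(1)[of v] leaf_extension_core_in_prune[of v]
        leaves_subset[of G]
      by (cases "v \<in> leaves G") auto
    then show "?\<tau> ` pverts G \<subseteq> pverts G" by blast
    show "?\<tau> v = v" if "v \<notin> pverts G" for v
      using that permutes_not_in[OF color_automorphism_permutes[OF aut], of v]
        leaf_extension_core[of v \<phi> \<sigma>]
      by (auto dest: subsetD[OF leaves_subset])
  qed (rule leaf_extension_arc)
  moreover have "\<phi> (?\<tau> v) = \<phi> v" if "v \<in> pverts G" for v
  proof (cases "v \<in> leaves G")
    case True
    then show ?thesis by (rule leaf_extension_leaf(3))
  next
    case False
    then show ?thesis
      using aut that
      by (simp add: color_automorphism_def pruned_coloring_def leaf_extension_core)
  qed
  ultimately show ?thesis by (simp add: color_automorphism_def)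
qed

end

lemma rigid_prune:
  assumes "rigid G \<phi>"
  shows "rigid (prune G) (pruned_coloring G \<phi>)"
  unfolding rigid_def
proof (intro allI impI ext)
  fix \<sigma> x assume aut: "color_automorphism (prune G) (pruned_coloring G \<phi>) \<sigma>"
  have "leaf_extension \<phi> \<sigma> = id"
    using color_automorphism_leaf_extension[OF aut inj_on_pendants_if_rigid[OF assms]] assms
    by (simp add: rigid_def)
  then have "\<sigma> v = v" if "v \<in> pverts (prune G)" for v
    using that leaf_extension_core[of v \<phi> \<sigma>] by simp
  then show "\<sigma> x = id x" using permutes_not_in[OF color_automorphism_permutes[OF aut], of x] by auto
qed

lemma rigid_if_rigid_prune:
  assumes rigid: "rigid (prune G) (pruned_coloring G \<phi>)"
    and inj: "\<And>v. v \<in> pverts (prune G) \<Longrightarrow> inj_on \<phi> (pendants G v)"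
  shows "rigid G \<phi>"
  unfolding rigid_def
proof (intro allI impI ext)
  fix \<sigma> x assume \<sigma>: "color_automorphism G \<phi> \<sigma>"
  then have aut: "graph_automorphism G \<sigma>" by (simp add: color_automorphism_def)
  have "perm_restrict \<sigma> (pverts (prune G)) = id"
    using rigid color_automorphism_prune[OF \<sigma>] by (simp add: rigid_def)
  then have fixed: "\<sigma> v = v" if "v \<in> pverts (prune G)" for v
    using that perm_restrict_simps(1)[of v "pverts (prune G)" \<sigma>] by simp
  consider (core) "x \<in> pverts (prune G)" | (leaf) "x \<in> leaves G" | (outside) "x \<notin> pverts G"
    by auto
  then show "\<sigma> x = id x"
  proof cases
    case core
    then show ?thesis using fixed by simp
  next
    case leaf
    note parent = parent_in_prune[OF leaf]
    have pendant: "x \<in> pendants G (parent x)" using leaf by (simp add: pendants_iff)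
    moreover have "\<sigma> x \<in> pendants G (parent x)"
      using pendant pendants_automorphism[OF aut, of "parent x"] fixed[OF parent] by auto
    moreover have "\<phi> (\<sigma> x) = \<phi> x"
      using \<sigma> leaf by (auto simp: color_automorphism_def dest: subsetD[OF leaves_subset])
    ultimately show ?thesis using inj_onD[OF inj[OF parent]] by simp
  next
    case outside
    then show ?thesis using permutes_not_in[OF graph_automorphism_permutes[OF aut]] by simp
  qed
qed

end

section \<open>Lists for the pruned graph\<close>

definition pruned_lists :: "'a pair_pre_digraph \<Rightarrow> ('a \<Rightarrow> 'c set) \<Rightarrow> 'a \<Rightarrow> ('c \<times> 'c set) set" where
  "pruned_lists G L v = L v \<times> transversals (pendants G v) L"

lemma pruned_coloring_in_pruned_lists:
  assumes "inj_on \<phi> (pendants G v)" "\<forall>u\<in>insert v (pendants G v). \<phi> u \<in> L u"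
  shows "pruned_coloring G \<phi> v \<in> pruned_lists G L v"
  using assms
  by (auto simp: pruned_coloring_def pruned_lists_def bij_betw_def intro!: transversalsI)

lemma separates_pruned_lists:
  assumes "separates (pverts G) K F"
  shows "separates (pverts (prune G)) (pruned_lists G K) (pruned_lists G F)"
  unfolding separates_def
proof (intro ballI disjCI)
  fix v w
  assume vw: "v \<in> pverts (prune G)" "w \<in> pverts (prune G)"
    and "pruned_lists G F v \<inter> pruned_lists G F w \<noteq> {}"
  then obtain c X where color: "c \<in> F v" "c \<in> F w"
    and transversal: "X \<in> transversals (pendants G v) F" "X \<in> transversals (pendants G w) F"
    by (auto simp: pruned_lists_def)
  have "K v = K w" using separatesD[OF assms _ _ color] vw by simp
  moreover have "separates (pendants G v \<union> pendants G w) K F"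
    using assms by (rule separates_subset) (simp add: pendants_subset)
  then have "transversals (pendants G v) K = transversals (pendants G w) K"
    using transversal by (rule separates_transversals_eq)
  ultimately show "pruned_lists G K v = pruned_lists G K w" by (simp add: pruned_lists_def)
qed

lemma (in pair_digraph) finite_pruned_lists:
  assumes "\<And>u. u \<in> pverts G \<Longrightarrow> finite (L u)" "v \<in> pverts G"
  shows "finite (pruned_lists G L v)"
  unfolding pruned_lists_def using assms
  by (intro finite_cartesian_product finite_transversals finite_pendants)
    (auto dest: subsetD[OF pendants_subset])

lemma (in pair_digraph) lists_dominate_pruned_lists:
  assumes "lists_dominate (pverts G) L K"
  shows "lists_dominate (pverts (prune G)) (pruned_lists G L) (pruned_lists G K)"
  unfolding lists_dominate_def
proof (intro conjI ballI)
  show "separates (pverts (prune G)) (pruned_lists G K) (pruned_lists G K)"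
    "separates (pverts (prune G)) (pruned_lists G K) (pruned_lists G L)"
    using assms by (simp_all add: lists_dominate_def separates_pruned_lists del: prune_simps)
  fix v assume "v \<in> pverts (prune G)"
  then have v: "v \<in> pverts G" by simp
  with assms show "finite (pruned_lists G K v)" "finite (pruned_lists G L v)"
    by (simp_all add: lists_dominate_def finite_pruned_lists)
  have "card (transversals (pendants G v) K) \<le> card (transversals (pendants G v) L)"
    using lists_dominate_subset[OF assms pendants_subset]
    by (intro lists_dominate_imp_card_transversals_le finite_pendants)
  then show "card (pruned_lists G K v) \<le> card (pruned_lists G L v)"
    using assms v
    by (simp add: pruned_lists_def card_cartesian_product lists_dominate_def mult_mono)
qed

lemma (in prunable_graph) exists_coloring_with_pruned_coloring:
  assumes "\<forall>v\<in>pverts (prune G). g v \<in> pruned_lists G L v"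
  shows "\<exists>f. (\<forall>v\<in>pverts G. f v \<in> L v) \<and>
    (\<forall>v\<in>pverts (prune G). inj_on f (pendants G v) \<and> pruned_coloring G f v = g v)"
proof -
  have "\<forall>v\<in>pverts (prune G). \<exists>e.
      bij_betw e (pendants G v) (snd (g v)) \<and> (\<forall>u\<in>pendants G v. e u \<in> L u)"
    using assms by (simp add: pruned_lists_def mem_Times_iff transversals_def)
  then obtain e where e_bij: "bij_betw (e v) (pendants G v) (snd (g v))"
    and e_in: "\<forall>u\<in>pendants G v. e v u \<in> L u" if "v \<in> pverts (prune G)" for v
    by metis
  define f where "f x = (if x \<in> leaves G then e (parent x) x else fst (g x))" for x
  have f_pendant: "f u = e v u" if "u \<in> pendants G v" for u v
    using that by (simp add: f_def pendants_iff)
  have f_bij: "bij_betw f (pendants G v) (snd (g v))" if "v \<in> pverts (prune G)" for v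
    using e_bij[OF that] f_pendant by (subst bij_betw_cong[of _ _ "e v"]) auto
  have "f v \<in> L v" if "v \<in> pverts G" for v
    using that assms e_in[OF parent_in_prune]
    by (auto simp: f_def pendants_iff pruned_lists_def mem_Times_iff)
  moreover have "inj_on f (pendants G v) \<and> pruned_coloring G f v = g v"
    if "v \<in> pverts (prune G)" for v
    using f_bij[OF that] that by (simp add: bij_betw_def pruned_coloring_def f_def)
  ultimately show ?thesis by blast
qed

definition color_encode :: "nat \<times> nat set \<Rightarrow> nat" where
  "color_encode = prod_encode \<circ> apsnd set_encode"

lemma inj_on_color_encode: "inj_on color_encode (UNIV \<times> Collect finite)"
  by (auto simp: color_encode_def inj_on_def set_encode_eq)

lemma (in pair_digraph) pruned_lists_subset: "pruned_lists G L v \<subseteq> UNIV \<times> Collect finite"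
  using finite_transversal[OF finite_pendants] by (auto simp: pruned_lists_def)

lemma (in pair_digraph) distinguishing_color_encode_iff:
  assumes "\<forall>v\<in>pverts (prune G). \<psi> v \<in> pruned_lists G L v"
  shows "distinguishing (prune G) (color_encode \<circ> \<psi>) \<longleftrightarrow> rigid (prune G) \<psi>"
proof -
  have "inj_on color_encode (\<psi> ` pverts (prune G))"
    using assms pruned_lists_subset by (intro inj_on_subset[OF inj_on_color_encode]) blast
  then show ?thesis unfolding distinguishing_iff_rigid by (rule rigid_comp_inj_iff)
qed

lemma (in prunable_graph) list_distinguishable_if_prune:
  assumes "list_distinguishable (prune G) (\<lambda>v. color_encode ` pruned_lists G L v)"
  shows "list_distinguishable G L"
proof -
  obtain f' where distinguishing_f': "distinguishing (prune G) f'"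
    and "\<forall>v\<in>pverts (prune G). f' v \<in> color_encode ` pruned_lists G L v"
    using assms unfolding list_distinguishable_def by blast
  then have "\<forall>v\<in>pverts (prune G). \<exists>p. p \<in> pruned_lists G L v \<and> f' v = color_encode p"
    by blast
  from bchoice[OF this] obtain g where
    f'_eq: "\<forall>v\<in>pverts (prune G). g v \<in> pruned_lists G L v \<and> f' v = color_encode (g v)"
    by blast
  then have g_in: "\<forall>v\<in>pverts (prune G). g v \<in> pruned_lists G L v" by blast
  obtain f where f_in: "\<forall>v\<in>pverts G. f v \<in> L v"
    and f_prune: "\<forall>v\<in>pverts (prune G). inj_on f (pendants G v) \<and> pruned_coloring G f v = g v"
    using exists_coloring_with_pruned_coloring[OF g_in] by blast
  have "rigid (prune G) (color_encode \<circ> g)"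
    using distinguishing_f' f'_eq
    by (subst rigid_cong[of _ _ f']) (auto simp: distinguishing_iff_rigid)
  then have "rigid (prune G) g"
    using distinguishing_color_encode_iff[OF g_in] by (simp add: distinguishing_iff_rigid)
  then have "rigid (prune G) (pruned_coloring G f)"
    using f_prune by (subst rigid_cong[of _ _ g]) auto
  then have "rigid G f" using f_prune by (intro rigid_if_rigid_prune) auto
  then show ?thesis
    using f_in unfolding list_distinguishable_def distinguishing_iff_rigid by blast
qed

lemma (in prunable_graph) distinguishing_prune:
  assumes "distinguishing G \<phi>" "\<forall>v\<in>pverts G. \<phi> v \<in> K v"
  defines "\<psi> \<equiv> color_encode \<circ> pruned_coloring G \<phi>"
  shows "distinguishing (prune G) \<psi>"
    and "\<forall>v\<in>pverts (prune G). \<psi> v \<in> color_encode ` pruned_lists G K v"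
proof -
  have rigid: "rigid G \<phi>" using assms(1) by (simp add: distinguishing_iff_rigid)
  have lists: "\<forall>v\<in>pverts (prune G). pruned_coloring G \<phi> v \<in> pruned_lists G K v"
    using inj_on_pendants_if_rigid[OF rigid] assms(2)
    by (intro ballI pruned_coloring_in_pruned_lists) (auto dest: subsetD[OF pendants_subset])
  then show "\<forall>v\<in>pverts (prune G). \<psi> v \<in> color_encode ` pruned_lists G K v"
    by (simp add: \<psi>_def)
  show "distinguishing (prune G) \<psi>"
    unfolding \<psi>_def distinguishing_color_encode_iff[OF lists] using rigid by (rule rigid_prune)
qed

section \<open>Trees\<close>

lemma (in pair_sym_digraph) mk_symmetric_eq: "mk_symmetric (with_proj G) = G"
  using arcs_symmetric by (intro pair_pre_digraph.equality) (auto simp: parcs_mk_symmetric)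

lemma (in pair_sym_digraph) connected_iff_strongly_connected:
  "connected (with_proj G) \<longleftrightarrow> strongly_connected (with_proj G)"
  by (simp add: connected_def mk_symmetric_eq)

lemma (in pair_sym_digraph) connected_subset_closed:
  assumes "connected (with_proj G)" "u \<in> pverts G" "u \<in> S"
    and closed: "\<And>v w. v \<in> S \<Longrightarrow> (v, w) \<in> parcs G \<Longrightarrow> w \<in> S"
  shows "pverts G \<subseteq> S"
proof
  fix w assume "w \<in> pverts G"
  then have "u \<rightarrow>\<^sup>*\<^bsub>with_proj G\<^esub> w"
    using assms(1,2) by (auto simp: connected_iff_strongly_connected)
  then show "w \<in> S"
    by (induction rule: reachable_induct) (use assms(3) closed in auto)
qed

lemma (in pair_graph) prunable_graph_if_connected:
  assumes "connected (with_proj G)" "3 \<le> card (pverts G)"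
  shows "prunable_graph G"
proof
  fix u v assume uv: "u \<in> leaves G" "v \<in> leaves G"
  show "(u, v) \<notin> parcs G"
  proof
    assume "(u, v) \<in> parcs G"
    then have "v \<in> neighbours G u" "u \<in> neighbours G v"
      using arcs_symmetric by (auto simp: neighbours_def)
    moreover have "card (neighbours G u) = 1" "card (neighbours G v) = 1"
      using uv by (auto simp: leaves_def)
    ultimately have "neighbours G u = {v}" "neighbours G v = {u}"
      by (auto simp: card_1_singleton_iff)
    then have "pverts G \<subseteq> {u, v}"
      using uv(1) by (intro connected_subset_closed[OF assms(1)])
        (auto simp: leaves_def neighbours_def)
    then have "card (pverts G) \<le> card {u, v}" by (intro card_mono) auto
    also have "\<dots> \<le> 2" by (simp add: card_insert_if)
    finally show False using assms(2) by simp
  qed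
qed

context prunable_graph
begin

definition retract :: "'a \<Rightarrow> 'a" where
  "retract x = (if x \<in> leaves G then parent x else x)"

lemma retract_in_prune: "x \<in> pverts G \<Longrightarrow> retract x \<in> pverts (prune G)"
  using parent_in_prune[of x] by (simp add: retract_def)

lemma retract_arc:
  assumes "(x, y) \<in> parcs G"
  shows "retract x = retract y \<or> (retract x, retract y) \<in> parcs (prune G)"
proof -
  consider (tail_leaf) "x \<in> leaves G" | (head_leaf) "y \<in> leaves G"
    | (core) "x \<notin> leaves G" "y \<notin> leaves G"
    by blast
  then show ?thesis
  proof cases
    case tail_leaf
    then show ?thesis
      using assms parent_in_prune[OF tail_leaf] by (simp add: leaf_arc_iff retract_def)
  next
    case head_leaf
    then have "x = parent y" using arcs_symmetric[OF assms] by (simp add: leaf_arc_iff)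
    then show ?thesis using head_leaf parent_in_prune[OF head_leaf] by (simp add: retract_def)
  next
    case core
    then show ?thesis using assms in_arcsD1 in_arcsD2 by (simp add: retract_def)
  qed
qed

lemma retract_reachable:
  assumes "u \<rightarrow>\<^sup>*\<^bsub>with_proj G\<^esub> v"
  shows "retract u \<rightarrow>\<^sup>*\<^bsub>with_proj (prune G)\<^esub> retract v"
proof -
  interpret P: pair_graph "prune G" by (rule pair_graph_prune)
  from assms show ?thesis
  proof (induction rule: reachable_induct)
    case base
    then show ?case using retract_in_prune by (intro P.reachable_refl)
  next
    case (step x y)
    then consider (collapsed) "retract x = retract y"
      | (arc) "(retract x, retract y) \<in> parcs (prune G)"
      using retract_arc by auto
    then show ?case
      using step.IH by cases (auto intro: P.reachable_adj_trans simp del: prune_simps)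
  qed
qed

lemma connected_prune:
  assumes "connected (with_proj G)"
  shows "connected (with_proj (prune G))"
proof -
  interpret P: pair_graph "prune G" by (rule pair_graph_prune)
  have "u \<rightarrow>\<^sup>*\<^bsub>with_proj (prune G)\<^esub> v"
    if "u \<in> pverts (prune G)" "v \<in> pverts (prune G)" for u v
    using that retract_reachable[of u v] assms
    by (auto simp: connected_iff_strongly_connected retract_def)
  moreover have "pverts G \<noteq> {}"
    using assms by (simp add: connected_iff_strongly_connected strongly_connected_def)
  then have "pverts (prune G) \<noteq> {}" using retract_in_prune by blast
  ultimately show ?thesis by (simp add: P.connected_iff_strongly_connected strongly_connected_def)
qed

end

lemma (in pair_wf_digraph) cycle_if_apath_arc:
  assumes "apath u p v" "(v, u) \<in> parcs G"
  shows "cycle (p @ [(v, u)])"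
proof -
  have walk: "awalk u (p @ [(v, u)]) u"
    using assms by (intro awalk_appendI) (auto simp: apath_def awalk_simps in_arcsD2)
  have "distinct (pawalk_verts u p)" "hd (pawalk_verts u p) = u"
    using assms(1) by (auto simp: apath_def)
  then obtain ws where ws: "pawalk_verts u p = u # ws" "distinct (u # ws)"
    by (cases "pawalk_verts u p") auto
  then have "pawalk_verts u (p @ [(v, u)]) = u # ws @ [u]"
    using awalk_verts_append[OF walk] by simp
  then show ?thesis using walk ws(2) unfolding cycle_def by force
qed

lemma (in pair_fin_digraph) exists_unextendable_apath:
  assumes "pverts G \<noteq> {}"
  shows "\<exists>u p v. apath u p v \<and> (\<forall>w. (w, u) \<in> parcs G \<longrightarrow> w \<in> set (pawalk_verts u p))"
proof -
  define lengths where "lengths = {length p | u p v. apath u p v}"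
  have "lengths \<subseteq> {..<card (pverts G)}" using length_apath_less by (auto simp: lengths_def)
  then have fin: "finite lengths" by (rule finite_subset) simp
  obtain x where "x \<in> pverts G" using assms by blast
  then have "apath x [] x" by (simp add: apath_Nil_iff)
  then have "lengths \<noteq> {}" by (auto simp: lengths_def)
  then have "Max lengths \<in> lengths" using fin by (rule Max_in[rotated])
  then obtain u p v where path: "apath u p v" and longest: "length p = Max lengths"
    by (auto simp: lengths_def)
  have "w \<in> set (pawalk_verts u p)" if "(w, u) \<in> parcs G" for w
  proof (rule ccontr)
    assume "w \<notin> set (pawalk_verts u p)"
    then have "apath w ((w, u) # p) v" using path that by (simp add: apath_Cons_iff)
    then have "length ((w, u) # p) \<in> lengths" unfolding lengths_def by blast
    then show False using Max_ge[OF fin] longest by fastforce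
  qed
  then show ?thesis using path by blast
qed

lemma (in pair_graph) exists_cycle_if_two_neighbours:
  assumes "pverts G \<noteq> {}" "\<And>v. v \<in> pverts G \<Longrightarrow> 2 \<le> card (neighbours G v)"
  shows "\<exists>p. cycle p \<and> 3 \<le> length p"
proof -
  obtain u p v where path: "apath u p v"
    and unextendable: "\<And>w. (w, u) \<in> parcs G \<Longrightarrow> w \<in> set (pawalk_verts u p)"
    using exists_unextendable_apath[OF assms(1)] by blast
  have "u \<in> pverts G" using path by (auto simp: apath_def)
  then have "\<not> neighbours G u \<subseteq> {snd (hd p)}" \<comment> \<open>for \<open>p = []\<close> this excludes an arbitrary vertex\<close>
    using assms(2) card_mono[of "{snd (hd p)}" "neighbours G u"] by fastforce
  then obtain w where uw: "(u, w) \<in> parcs G" and not_second: "w \<noteq> snd (hd p)"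
    by (auto simp: neighbours_def)
  note wu = arcs_symmetric[OF uw]
  obtain q r where split: "p = q @ r" and walk: "awalk u q w"
    using awalk_decomp[OF awalkI_apath[OF path] unextendable[OF wu]] by blast
  have "apath u q w" using path split walk by (auto simp: apath_append_iff)
  then have "cycle (q @ [(w, u)])" using wu by (rule cycle_if_apath_arc)
  moreover have "2 \<le> length q"
  proof -
    have "length q \<noteq> 0" using walk no_loops'[OF wu] by (auto simp: awalk_Nil_iff)
    moreover have "length q \<noteq> 1"
      using split walk not_second by (auto simp: length_Suc_conv awalk_simps)
    ultimately show ?thesis by linarith
  qed
  ultimately show ?thesis by (intro exI[of _ "q @ [(w, u)]"]) simp
qed

lemma leaves_nonempty_if_undirected_tree:
  assumes "undirected_tree G" "2 \<le> card (pverts G)"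
  shows "leaves G \<noteq> {}"
proof -
  interpret pair_graph G using assms(1) by (simp add: undirected_tree_def)
  have conn: "connected (with_proj G)" using assms(1) by (simp add: undirected_tree_def)
  have "pverts G \<noteq> {}" using assms(2) by auto
  then obtain v where v: "v \<in> pverts G" and degree: "card (neighbours G v) < 2"
    using assms(1) exists_cycle_if_two_neighbours unfolding undirected_tree_def
    by (meson not_le)
  have "\<not> pverts G \<subseteq> {v}"
    using assms(2) card_mono[of "{v}" "pverts G"] by auto
  then have "neighbours G v \<noteq> {}"
    using connected_subset_closed[OF conn v, of "{v}"] by (auto simp: neighbours_def)
  then have "card (neighbours G v) \<noteq> 0" using finite_neighbours by simp
  then show ?thesis using v degree by (auto simp: leaves_def)
qed

lemma (in prunable_graph) undirected_tree_prune:
  assumes "undirected_tree G"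
  shows "undirected_tree (prune G)"
proof -
  interpret P: pair_graph "prune G" by (rule pair_graph_prune)
  have "subgraph (with_proj (prune G)) (with_proj G)"
    by (auto simp: subgraph_def compatible_def wf_digraph_wp_iff) unfold_locales
  then have "cycle p" if "pre_digraph.cycle (with_proj (prune G)) p" for p
    using that by (rule subgraph_cycle)
  then show ?thesis
    using assms connected_prune P.pair_graph unfolding undirected_tree_def by blast
qed

section \<open>From colorings to list colorings\<close>

lemma list_distinguishable_if_lists_dominate:
  assumes "undirected_tree G" "lists_dominate (pverts G) L K"
    and "distinguishing G \<phi>" "\<forall>v\<in>pverts G. \<phi> v \<in> K v"
  shows "list_distinguishable G L"
  using assms
proof (induction "card (pverts G)" arbitrary: G K L \<phi> rule: less_induct)
  case less
  interpret pair_graph G using less.prems(1) by (simp add: undirected_tree_def)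
  show ?case
  proof (cases "card (pverts G) \<le> 2")
    case True
    then have "inj_on \<phi> (pverts G)"
      using less.prems(3)
      by (intro inj_on_if_rigid_card_le_2) (simp_all add: distinguishing_iff_rigid)
    then obtain f where "inj_on f (pverts G)" "\<forall>v\<in>pverts G. f v \<in> L v"
      using lists_dominate_inj_choice[OF pair_finite_verts less.prems(2)] less.prems(4) by blast
    then show ?thesis
      unfolding list_distinguishable_def using inj_on_imp_distinguishing by blast
  next
    case False
    then interpret prunable_graph G
      using less.prems(1) by (intro prunable_graph_if_connected) (auto simp: undirected_tree_def)
    have "leaves G \<noteq> {}"
      using leaves_nonempty_if_undirected_tree[OF less.prems(1)] False by simp
    then have "pverts (prune G) \<subset> pverts G" using leaves_subset[of G] by auto
    then have smaller: "card (pverts (prune G)) < card (pverts G)"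
      using pair_finite_verts by (intro psubset_card_mono)
    have inj: "inj_on color_encode (\<Union>v\<in>S. pruned_lists G F v)" for F S
      using pruned_lists_subset by (intro inj_on_subset[OF inj_on_color_encode]) blast
    have "list_distinguishable (prune G) (\<lambda>v. color_encode ` pruned_lists G L v)"
      using smaller undirected_tree_prune[OF less.prems(1)]
        lists_dominate_image[OF lists_dominate_pruned_lists[OF less.prems(2)] inj inj]
        distinguishing_prune[OF less.prems(3,4)]
      by (rule less.hyps)
    then show ?thesis by (rule list_distinguishable_if_prune)
  qed
qed

lemma distinguishing_number_le_list_distinguishing_number:
  assumes "finite (pverts G)"
  shows "distinguishing_number G \<le> list_distinguishing_number G"
proof -
  let ?k = "list_distinguishing_number G"
  have "list_distinguishable G (\<lambda>_. {1..?k})"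
    using assms by (intro list_distinguishing_number_attained) auto
  then have "\<exists>\<phi>. k_coloring G ?k \<phi> \<and> distinguishing G \<phi>"
    unfolding list_distinguishable_def k_coloring_def by blast
  then show ?thesis unfolding distinguishing_number_def by (rule Least_le)
qed

theorem theorem1:
  fixes T :: "'a pair_pre_digraph"
  assumes "undirected_tree T"
  shows "distinguishing_number T = list_distinguishing_number T"
proof (rule antisym)
  interpret pair_graph T using assms by (simp add: undirected_tree_def)
  show "distinguishing_number T \<le> list_distinguishing_number T"
    using pair_finite_verts by (rule distinguishing_number_le_list_distinguishing_number)
  let ?k = "distinguishing_number T"
  obtain \<phi> where \<phi>: "k_coloring T ?k \<phi>" "distinguishing T \<phi>"
    using distinguishing_number_attained[OF pair_finite_verts] by blast
  have "list_distinguishable T L" if "\<forall>v\<in>pverts T. finite (L v) \<and> card (L v) = ?k" for L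
  proof -
    have "lists_dominate (pverts T) L (\<lambda>_. {1..?k})"
      using that by (simp add: lists_dominate_def separates_def)
    then show ?thesis
      using list_distinguishable_if_lists_dominate[OF assms] \<phi> by (auto simp: k_coloring_def)
  qed
  then show "list_distinguishing_number T \<le> ?k"
    unfolding list_distinguishing_number_def by (intro Least_le) blast
qed

end
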